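(* Let $\varphi(z)=1+B_1z+B_2z^2+B_3z^3+\cdots$ be a Ma–Minda function on $\mathbb{D}$ (so in particular $B_1>0$ and all $B_i$ are real), and let $f\in\mathcal{S}^*(\varphi)$ have logarithmic coefficients $\gamma_1,\gamma_2,\dots$. If $|B_2|\ge B_1$, then $$|\gamma_1^2-\gamma_2^2|\le \frac{B_1^2}{4}+\frac{B_2^2}{16}.$$ The estimate is sharp: for every such $\varphi$ with $|B_2|\ge B_1$ there is a function in $\mathcal{S}^*(\varphi)$ for which equality holds.
   Context: $\mathbb{D}=\{z\in\mathbb{C}:|z|<1\}$. $\mathcal{S}$ is the class of univalent analytic functions $f$ on $\mathbb{D}$ of the form $f(z)=z+\sum_{n\ge2}a_nz^n$. The logarithmic coefficients $\gamma_n=\gamma_n(f)$ of $f\in\mathcal{S}$ are defined by $\log\frac{f(z)}{z}=2\sum_{n=1}^\infty\gamma_nz^n$, $z\in\mathbb{D}$, where $\log 1=0$. A Schwarz function is an analytic $\omega:\mathbb{D}\to\mathbb{D}$ with $\omega(0)=0$. For analytic $g,h$ on $\mathbb{D}$, $g\prec h$ ($g$ is subordinate to $h$) means $g=h\circ\omega$ for some Schwarz function $\omega$. A Ma–Minda function is an analytic univalent function $\varphi$ on $\mathbb{D}$ with positive real part such that $\varphi(0)=1$, $\varphi'(0)>0$, and $\varphi(\mathbb{D})$ is symmetric with respect to the real axis and starlike with respect to $\varphi(0)=1$. Its Taylor expansion is written $\varphi(z)=1+B_1z+B_2z^2+B_3z^3+\cdots$, $B_1>0$. $\mathcal{S}^*(\varphi)=\{f\in\mathcal{S}: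 zf'(z)/f(z)\prec\varphi(z)\}$. *)

theory Defs
  imports "HOL-Complex_Analysis.Complex_Analysis"
begin

abbreviation unit_disc :: "complex set" ("\<bbbD>")
  where "\<bbbD> \<equiv> ball 0 1"

definition taylor_coeff :: "(complex \<Rightarrow> complex) \<Rightarrow> nat \<Rightarrow> complex"
  where "taylor_coeff g n = (deriv ^^ n) g 0 / fact n"

definition class_S :: "(complex \<Rightarrow> complex) set"
  where "class_S = {f. f holomorphic_on \<bbbD> \<and> inj_on f \<bbbD> \<and> f 0 = 0 \<and> deriv f 0 = 1}"

text \<open>
  The function \<open>L\<close> is the analytic branch of \<open>log (f z / z)\<close> on the disc with \<open>log 1 = 0\<close>;
  the value of \<open>f z / z\<close> at the removable singularity \<open>0\<close> is \<open>f'(0) = 1\<close>, hence \<open>L 0 = 0\<close>.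
  The index \<open>0\<close> does not occur in the expansion; the coefficient there is fixed to be \<open>0\<close>,
  so that for \<open>f\<close> in the class the sequence is uniquely determined.
\<close>

definition has_log_coeffs :: "(complex \<Rightarrow> complex) \<Rightarrow> (nat \<Rightarrow> complex) \<Rightarrow> bool"
  where "has_log_coeffs f \<gamma> \<longleftrightarrow> \<gamma> 0 = 0 \<and>
    (\<exists>L. L holomorphic_on \<bbbD> \<and> L 0 = 0 \<and>
         (\<forall>z\<in>\<bbbD> - {0}. exp (L z) = f z / z) \<and>
         (\<forall>z\<in>\<bbbD>. (\<lambda>n. 2 * \<gamma> n * z ^ n) sums L z))"

definition log_coeff :: "(complex \<Rightarrow> complex) \<Rightarrow> nat \<Rightarrow> complex"
  where "log_coeff f = (THE \<gamma>. has_log_coeffs f \<gamma>)"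

definition schwarz_function :: "(complex \<Rightarrow> complex) \<Rightarrow> bool"
  where "schwarz_function \<omega> \<longleftrightarrow> \<omega> holomorphic_on \<bbbD> \<and> \<omega> ` \<bbbD> \<subseteq> \<bbbD> \<and> \<omega> 0 = 0"

definition subordinate :: "(complex \<Rightarrow> complex) \<Rightarrow> (complex \<Rightarrow> complex) \<Rightarrow> bool" (infix "\<prec>\<^sub>s" 50)
  where "g \<prec>\<^sub>s h \<longleftrightarrow> (\<exists>\<omega>. schwarz_function \<omega> \<and> (\<forall>z\<in>\<bbbD>. g z = h (\<omega> z)))"

definition starlike_wrt :: "complex set \<Rightarrow> complex \<Rightarrow> bool"
  where "starlike_wrt A a \<longleftrightarrow> a \<in> A \<and> (\<forall>w\<in>A. closed_segment a w \<subseteq> A)"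

definition ma_minda :: "(complex \<Rightarrow> complex) \<Rightarrow> bool"
  where "ma_minda \<phi> \<longleftrightarrow>
    \<phi> holomorphic_on \<bbbD> \<and> inj_on \<phi> \<bbbD> \<and> (\<forall>z\<in>\<bbbD>. Re (\<phi> z) > 0) \<and>
    \<phi> 0 = 1 \<and> deriv \<phi> 0 \<in> \<real> \<and> Re (deriv \<phi> 0) > 0 \<and>
    cnj ` (\<phi> ` \<bbbD>) = \<phi> ` \<bbbD> \<and> starlike_wrt (\<phi> ` \<bbbD>) 1"

text \<open>
  At \<open>z = 0\<close> the quotient \<open>z f'(z) / f(z)\<close> has a removable singularity with value \<open>1\<close>,
  whereas \<open>0 / 0 = 0\<close> in HOL.
\<close>

definition starlike_quotient :: "(complex \<Rightarrow> complex) \<Rightarrow> complex \<Rightarrow> complex"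
  where "starlike_quotient f z = (if z = 0 then 1 else z * deriv f z / f z)"

definition class_S_star :: "(complex \<Rightarrow> complex) \<Rightarrow> (complex \<Rightarrow> complex) set"
  where "class_S_star \<phi> = {f \<in> class_S. starlike_quotient f \<prec>\<^sub>s \<phi>}"

end

theory Submission
  imports Defs
begin

text \<open>
  Write \<open>f z = z * exp (L z)\<close>. Then \<open>1 + z * L' z = \<phi> (\<omega> z)\<close> with a Schwarz function
  \<open>\<omega> z = c\<^sub>1 z + c\<^sub>2 z\<^sup>2 + \<dots>\<close>, so \<open>2 \<gamma>\<^sub>1 = B\<^sub>1 c\<^sub>1\<close> and
  \<open>4 \<gamma>\<^sub>2 = B\<^sub>1 c\<^sub>2 + B\<^sub>2 c\<^sub>1\<^sup>2\<close>. Since \<open>\<bar>c\<^sub>2\<bar> \<le> 1 - \<bar>c\<^sub>1\<bar>\<^sup>2\<close> and \<open>B\<^sub>1 \<le> \<bar>B\<^sub>2\<bar>\<close>,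
  this gives \<open>4 \<bar>\<gamma>\<^sub>2\<bar> \<le> \<bar>B\<^sub>2\<bar>\<close>, and the triangle inequality finishes the estimate. Equality
  holds for \<open>\<omega> z = \<i> z\<close>, which makes \<open>\<gamma>\<^sub>1\<^sup>2\<close> negative and \<open>\<gamma>\<^sub>2\<^sup>2\<close> positive.

  The extremal \<open>f\<close> is univalent because in the coordinate \<open>z = exp \<zeta>\<close> on the left half-plane
  \<open>log f\<close> becomes \<open>\<zeta> + L (exp \<zeta>)\<close>, whose derivative \<open>\<phi> (\<omega> (exp \<zeta>))\<close> has positive real part.
  The coefficients of \<open>\<phi>\<close> are real because \<open>cnj \<circ> \<phi> \<circ> cnj\<close> is a univalent map onto the same
  domain with the same normalisation at \<open>0\<close>, hence equals \<open>\<phi>\<close> by the Schwarz lemma.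
\<close>

section \<open>Univalence from positivity of a real part\<close>

text \<open>Noshiro-Warschawski criterion. If \<open>f a = f b\<close>, the complex mean value
  theorem for \<open>f\<close> divided by \<open>b - a\<close> yields a point of the segment where
  \<open>Re (f' u) = 0\<close>.\<close>

lemma convex_Re_deriv_pos_imp_inj_on:
  assumes "convex S"
    and f: "\<And>z. z \<in> S \<Longrightarrow> (f has_field_derivative f' z) (at z)"
    and pos: "\<And>z. z \<in> S \<Longrightarrow> Re (f' z) > 0"
  shows "inj_on f S"
proof (rule inj_onI, rule ccontr)
  fix a b assume ab: "a \<in> S" "b \<in> S" "f a = f b" "a \<noteq> b"
  have seg: "closed_segment a b \<subseteq> S"
    using ab \<open>convex S\<close> by (simp add: closed_segment_subset)
  have "\<exists>u. u \<in> closed_segment a b \<and>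
      Re (f b / (b - a)) - Re (f a / (b - a)) = Re (f' u / (b - a) * (b - a))"
    by (rule complex_mvt_line) (use seg f in \<open>auto intro!: DERIV_cdivide\<close>)
  then obtain u where "u \<in> closed_segment a b" "Re (f' u) = 0"
    using ab by auto
  then show False using pos seg by force
qed

lemma inj_on_times_exp:
  assumes L: "L holomorphic_on \<bbbD>"
    and pos: "\<And>z. z \<in> \<bbbD> \<Longrightarrow> Re (1 + z * deriv L z) > 0"
  shows "inj_on (\<lambda>z. z * exp (L z)) \<bbbD>"
proof (rule inj_onI)
  fix a b assume ab: "a \<in> \<bbbD>" "b \<in> \<bbbD>" "a * exp (L a) = b * exp (L b)"
  show "a = b"
  proof (cases "a = 0 \<or> b = 0")
    case True
    then show ?thesis using ab by auto
  next
    case False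
    define F where "F = (\<lambda>\<zeta>. \<zeta> + L (exp \<zeta>))"
    have expD: "exp \<zeta> \<in> \<bbbD>" if "\<zeta> \<in> {\<zeta>. Re \<zeta> < 0}" for \<zeta>
      using that by simp
    have "inj_on F {\<zeta>. Re \<zeta> < 0}"
    proof (rule convex_Re_deriv_pos_imp_inj_on)
      fix \<zeta> :: complex assume \<zeta>: "\<zeta> \<in> {\<zeta>. Re \<zeta> < 0}"
      show "(F has_field_derivative (1 + exp \<zeta> * deriv L (exp \<zeta>))) (at \<zeta>)"
        unfolding F_def
        using DERIV_add[OF DERIV_ident
            DERIV_chain2[OF holomorphic_derivI[OF L open_ball expD[OF \<zeta>]] DERIV_exp]]
        by (simp add: mult.commute)
    qed (use pos expD in \<open>auto simp: convex_halfspace_Re_lt\<close>)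
    moreover have "\<exists>\<zeta>. Re \<zeta> < 0 \<and> exp \<zeta> = z" if "z \<in> \<bbbD>" "z \<noteq> 0" for z
      using that by (intro exI[of _ "Ln z"]) auto
    then obtain u v where u: "Re u < 0" "exp u = a" and v: "Re v < 0" "exp v = b"
      using ab False by meson
    have "exp (F u) = exp (F v)"
      using ab u v by (simp add: F_def exp_add)
    then obtain n :: int where n: "F u = F v + complex_of_real (of_int (2 * n) * pi) * \<i>"
      unfolding exp_eq by blast
    \<comment> \<open>\<open>exp\<close> has this period, so moving \<open>v\<close> to
      \<open>w\<close> leaves \<open>L (exp v)\<close> unchanged and shifts \<open>F\<close> by
      exactly the discrepancy between \<open>F u\<close> and \<open>F v\<close>.\<close>
    define w where "w = v + complex_of_real (of_int (2 * n) * pi) * \<i>"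
    have "exp w = exp v" unfolding exp_eq w_def by blast
    then have w: "exp w = b" using v by simp
    then have "F u = F w" using n \<open>exp w = exp v\<close> by (simp add: F_def w_def)
    moreover have "Re w < 0" using v by (simp add: w_def)
    ultimately have "u = w" using \<open>inj_on F _\<close> u by (auto dest: inj_onD)
    then show ?thesis using u w by simp
  qed
qed

section \<open>Taylor coefficients and logarithmic coefficients\<close>

lemma taylor_coeff_eqI:
  assumes "\<And>z. z \<in> \<bbbD> \<Longrightarrow> (\<lambda>n. a n * z ^ n) sums f z"
  shows "taylor_coeff f n = a n"
proof -
  have "f has_fps_expansion Abs_fps a"
    by (rule has_fps_expansionI)
      (auto intro!: eventually_mono[OF eventually_nhds_in_open[of \<bbbD>]] assms)
  then show ?thesis
    using fps_nth_fps_expansion[of f "Abs_fps a" n] by (simp add: taylor_coeff_def)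
qed

lemma taylor_coeff_sums:
  assumes "f holomorphic_on \<bbbD>" "z \<in> \<bbbD>"
  shows "(\<lambda>n. taylor_coeff f n * z ^ n) sums f z"
  using holomorphic_power_series[OF assms] by (simp add: taylor_coeff_def)

text \<open>Resolves the definite description in \<open>log_coeff\<close>. If \<open>M\<close> is
  another branch, \<open>exp (M z - L z)\<close> is constantly 1, so its derivative vanishes and
  \<open>M - L\<close> is constant; both branches are 0 at 0. The required
  \<open>\<gamma> 0 = 0\<close> amounts to \<open>L 0 = 0\<close>.\<close>

lemma log_coeff_eq:
  assumes L: "L holomorphic_on \<bbbD>" "L 0 = 0" "\<And>z. z \<in> \<bbbD> - {0} \<Longrightarrow> exp (L z) = f z / z"
  shows "log_coeff f n = taylor_coeff L n / 2"
proof -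
  have "has_log_coeffs f \<gamma> \<longleftrightarrow> \<gamma> = (\<lambda>n. taylor_coeff L n / 2)" for \<gamma>
  proof
    assume "has_log_coeffs f \<gamma>"
    then obtain M where M: "M holomorphic_on \<bbbD>" "M 0 = 0"
      "\<And>z. z \<in> \<bbbD> - {0} \<Longrightarrow> exp (M z) = f z / z"
      "\<And>z. z \<in> \<bbbD> \<Longrightarrow> (\<lambda>n. 2 * \<gamma> n * z ^ n) sums M z"
      unfolding has_log_coeffs_def by blast
    have "exp (M z) = exp (L z)" if "z \<in> \<bbbD>" for z
      using that M(2,3) L(2,3) by (cases "z = 0") auto
    then have eq1: "exp (M z - L z) = 1" if "z \<in> \<bbbD>" for z
      using that by (simp add: exp_diff)
    have "\<exists>c. \<forall>z\<in>\<bbbD>. M z - L z = c"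
    proof (rule has_field_derivative_zero_constant)
      fix z assume z: "z \<in> \<bbbD>"
      have d: "((\<lambda>z. M z - L z) has_field_derivative deriv M z - deriv L z) (at z)"
        by (intro derivative_intros holomorphic_derivI[OF M(1) open_ball z]
            holomorphic_derivI[OF L(1) open_ball z])
      have "((\<lambda>z. exp (M z - L z)) has_field_derivative
          exp (M z - L z) * (deriv M z - deriv L z)) (at z)"
        using DERIV_chain2[OF DERIV_exp d] .
      moreover have "((\<lambda>z. exp (M z - L z)) has_field_derivative 0) (at z)"
        by (rule has_field_derivative_transform_within_open[of "\<lambda>_. 1" _ _ \<bbbD>]) (use z eq1 in auto)
      ultimately have "deriv M z - deriv L z = 0"
        using DERIV_unique by fastforce
      with d show "((\<lambda>z. M z - L z) has_field_derivative 0) (at z within \<bbbD>)"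
        by (auto intro: has_field_derivative_at_within)
    qed auto
    then have "M z = L z" if "z \<in> \<bbbD>" for z
      using that M(2) L(2) by (metis centre_in_ball diff_self eq_iff_diff_eq_0 zero_less_one)
    then have "taylor_coeff L n = 2 * \<gamma> n" for n
      using M(4) by (intro taylor_coeff_eqI) auto
    then show "\<gamma> = (\<lambda>n. taylor_coeff L n / 2)" by simp
  next
    assume "\<gamma> = (\<lambda>n. taylor_coeff L n / 2)"
    then show "has_log_coeffs f \<gamma>"
      unfolding has_log_coeffs_def
      using L taylor_coeff_sums[OF L(1)]
      by (intro conjI exI[of _ L] ballI) (auto simp: taylor_coeff_def simp del: mem_ball_0)
  qed
  then show ?thesis by (simp add: log_coeff_def)
qed

lemma has_fps_expansion_taylor_coeff:
  assumes "f holomorphic_on \<bbbD>"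
  shows "f has_fps_expansion Abs_fps (taylor_coeff f)"
  using has_fps_expansion_fps_expansion[OF open_ball centre_in_ball[THEN iffD2] assms]
  by (simp add: fps_expansion_def taylor_coeff_def[abs_def])

text \<open>Both sides of the differential equation are expanded as formal power series and compared
  in degrees 1 and 2. Since \<open>\<omega> 0 = 0\<close>, the composition is a legitimate formal
  one and only finitely many terms enter each degree.\<close>

lemma taylor_coeff_1_2_of_log_derivative:
  assumes L: "L holomorphic_on \<bbbD>" and \<omega>: "schwarz_function \<omega>" and \<phi>: "\<phi> holomorphic_on \<bbbD>"
    and eq: "\<forall>z\<in>\<bbbD>. 1 + z * deriv L z = \<phi> (\<omega> z)"
  shows "taylor_coeff L 1 = taylor_coeff \<phi> 1 * taylor_coeff \<omega> 1"
    and "2 * taylor_coeff L 2 =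
      taylor_coeff \<phi> 1 * taylor_coeff \<omega> 2 + taylor_coeff \<phi> 2 * (taylor_coeff \<omega> 1)\<^sup>2"
proof -
  have \<omega>0: "taylor_coeff \<omega> 0 = 0" and \<omega>hol: "\<omega> holomorphic_on \<bbbD>"
    using \<omega> by (auto simp: schwarz_function_def taylor_coeff_def)
  have exL: "(\<lambda>z. 1 + z * deriv L z) has_fps_expansion
      1 + fps_X * fps_deriv (Abs_fps (taylor_coeff L))"
    by (intro fps_expansion_intros has_fps_expansion_taylor_coeff L)
  have ex\<phi>: "(\<phi> \<circ> \<omega>) has_fps_expansion
      fps_compose (Abs_fps (taylor_coeff \<phi>)) (Abs_fps (taylor_coeff \<omega>))"
    by (intro has_fps_expansion_compose has_fps_expansion_taylor_coeff \<omega>hol \<phi>) (simp add: \<omega>0)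
  have ev: "eventually (\<lambda>z. 1 + z * deriv L z = (\<phi> \<circ> \<omega>) z) (nhds 0)"
    using eq by (auto intro!: eventually_mono[OF eventually_nhds_in_open[of \<bbbD>]])
  have *: "1 + fps_X * fps_deriv (Abs_fps (taylor_coeff L)) =
      fps_compose (Abs_fps (taylor_coeff \<phi>)) (Abs_fps (taylor_coeff \<omega>))"
    by (rule fps_expansion_unique_complex[OF exL[unfolded has_fps_expansion_cong[OF ev refl]] ex\<phi>])
  show "taylor_coeff L 1 = taylor_coeff \<phi> 1 * taylor_coeff \<omega> 1"
    using arg_cong[OF *, of "\<lambda>F. fps_nth F 1"]
    by (simp add: fps_compose_nth)
  show "2 * taylor_coeff L 2 =
      taylor_coeff \<phi> 1 * taylor_coeff \<omega> 2 + taylor_coeff \<phi> 2 * (taylor_coeff \<omega> 1)\<^sup>2"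
    using arg_cong[OF *, of "\<lambda>F. fps_nth F 2"]
    by (simp add: fps_compose_nth numeral_2_eq_2 fps_mult_nth power2_eq_square \<omega>0)
qed

lemma taylor_coeff_Suc_times_ident:
  assumes "h holomorphic_on \<bbbD>" "\<And>z. z \<in> \<bbbD> \<Longrightarrow> f z = z * h z"
  shows "taylor_coeff f (Suc n) = taylor_coeff h n"
proof -
  have "(\<lambda>z. z * h z) has_fps_expansion fps_X * Abs_fps (taylor_coeff h)"
    by (intro fps_expansion_intros has_fps_expansion_taylor_coeff assms)
  moreover have ev: "eventually (\<lambda>z. f z = z * h z) (nhds 0)"
    using assms(2) by (auto intro!: eventually_mono[OF eventually_nhds_in_open[of \<bbbD>]])
  ultimately have "f has_fps_expansion fps_X * Abs_fps (taylor_coeff h)"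
    using has_fps_expansion_cong[OF ev refl] by simp
  from fps_nth_fps_expansion[OF this, of "Suc n"] show ?thesis
    by (simp add: taylor_coeff_def)
qed

section \<open>The second coefficient of a Schwarz function\<close>

text \<open>This is the Schwarz-Pick inequality at 0 for \<open>h z = \<omega> z / z\<close>, whose
  value and derivative at 0 are the two coefficients.\<close>

lemma schwarz_function_taylor_coeff_2_le:
  assumes "schwarz_function \<omega>"
  shows "cmod (taylor_coeff \<omega> 2) \<le> 1 - (cmod (taylor_coeff \<omega> 1))\<^sup>2"
proof -
  have hol: "\<omega> holomorphic_on \<bbbD>" and \<omega>0: "\<omega> 0 = 0"
    and lt: "\<And>z. cmod z < 1 \<Longrightarrow> cmod (\<omega> z) < 1"
    using assms by (auto simp: schwarz_function_def image_subset_iff)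
  obtain h where h: "h holomorphic_on \<bbbD>" "\<And>z. cmod z < 1 \<Longrightarrow> \<omega> z = z * h z" "deriv \<omega> 0 = h 0"
    using Schwarz3[OF hol \<omega>0] by metis
  have coeffs: "taylor_coeff \<omega> 1 = h 0" "taylor_coeff \<omega> 2 = deriv h 0"
    using taylor_coeff_Suc_times_ident[of h \<omega> 0] taylor_coeff_Suc_times_ident[of h \<omega> 1] h
    by (simp_all add: taylor_coeff_def numeral_2_eq_2)
  show ?thesis
  \<comment> \<open>Rotations are split off, since for them \<open>h\<close> is a constant of
    modulus 1 and the disc automorphism used below degenerates. Both sides of the bound are then
    0.\<close>
  proof (cases "\<exists>\<alpha>. (\<forall>z. cmod z < 1 \<longrightarrow> \<omega> z = \<alpha> * z) \<and> cmod \<alpha> = 1")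
    case True
    then obtain \<alpha> where \<alpha>: "\<And>z. cmod z < 1 \<Longrightarrow> \<omega> z = \<alpha> * z" "cmod \<alpha> = 1" by blast
    have "taylor_coeff \<omega> 1 = \<alpha>" "taylor_coeff \<omega> 2 = 0"
      using taylor_coeff_Suc_times_ident[of "\<lambda>_. \<alpha>" \<omega> 0]
        taylor_coeff_Suc_times_ident[of "\<lambda>_. \<alpha>" \<omega> 1] \<alpha>(1)
      by (simp_all add: taylor_coeff_def numeral_2_eq_2)
    then show ?thesis using \<alpha>(2) by simp
  next
    case False
    note schwarz = Schwarz_Lemma[OF hol \<omega>0 lt]
    \<comment> \<open>Equality at any single point, or in the derivative at 0, would force a
      rotation.\<close>
    have h_lt: "cmod (h z) < 1" if z: "cmod z < 1" for z
    proof (cases "z = 0")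
      case True
      then show ?thesis using schwarz(2)[of 0] schwarz(3)[of 0] False h(3) by fastforce
    next
      case False
      then have "cmod (\<omega> z) < cmod z"
        using schwarz(1)[OF _ z] schwarz(3)[of 0] \<open>\<nexists>\<alpha>. _\<close> z by fastforce
      then show ?thesis using h(2)[OF z] False by (simp add: norm_mult)
    qed
    define a where "a = h 0"
    \<comment> \<open>The automorphism \<open>w \<mapsto> (w - a) / (1 - cnj a * w)\<close> sends
      \<open>h 0\<close> to 0, so the Schwarz lemma bounds the derivative of \<open>m\<close> at
      0.\<close>
    define m where "m = Moebius_function 0 a \<circ> h"
    have a: "cmod a < 1" using h_lt[of 0] by (simp add: a_def)
    have aa: "cnj a * a = of_real ((cmod a)\<^sup>2)"
      by (metis complex_norm_square mult.commute)
    have sq: "(cmod a)\<^sup>2 < 1" using a by (simp add: abs_square_less_1)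
    then have nz: "1 - cnj a * a \<noteq> 0"
      unfolding aa by (metis eq_iff_diff_eq_0 less_irrefl of_real_eq_1_iff)
    have "m holomorphic_on \<bbbD>"
      unfolding m_def by (rule holomorphic_on_compose_gen[OF h(1) Moebius_function_holomorphic[OF a]])
        (use h_lt in auto)
    moreover have "m 0 = 0" by (simp add: m_def a_def Moebius_function_eq_zero)
    moreover have "cmod (m z) < 1" if "cmod z < 1" for z
      using Moebius_function_norm_lt_1[OF a h_lt[OF that]] by (simp add: m_def)
    ultimately have le: "cmod (deriv m 0) \<le> 1"
      using Schwarz_Lemma(2)[of m 0] by simp
    have "(h has_field_derivative deriv h 0) (at 0)"
      using holomorphic_derivI[OF h(1)] by simp
    then have "((\<lambda>z. h z - a) has_field_derivative deriv h 0) (at 0)"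
        "((\<lambda>z. 1 - cnj a * h z) has_field_derivative - (cnj a * deriv h 0)) (at 0)"
      by (auto intro!: derivative_eq_intros)
    from DERIV_divide[OF this] have "((\<lambda>z. (h z - a) / (1 - cnj a * h z)) has_field_derivative
        deriv h 0 / (1 - cnj a * a)) (at 0)"
      using nz by (simp add: a_def)
    then have "deriv m 0 = deriv h 0 / (1 - cnj a * a)"
      by (auto simp: m_def o_def Moebius_function_simple intro!: DERIV_imp_deriv)
    then have "cmod (deriv h 0) \<le> cmod (1 - cnj a * a)"
      using le nz by (simp add: norm_divide field_simps)
    also have "1 - cnj a * a = of_real (1 - (cmod a)\<^sup>2)"
      unfolding aa by simp
    also have "cmod \<dots> = 1 - (cmod a)\<^sup>2"
      using sq by (simp only: norm_of_real)
    finally show ?thesis unfolding coeffs a_def .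
  qed
qed

section \<open>Reality of the Taylor coefficients\<close>

text \<open>The map \<open>k\<close>, the inverse of \<open>\<phi>\<close> applied after
  \<open>\<psi>\<close>, sends the disc into itself, fixes 0 and has derivative 1 there. The
  equality case of the Schwarz lemma makes it a rotation, hence the identity.\<close>

lemma univalent_unique:
  assumes \<phi>: "\<phi> holomorphic_on \<bbbD>" "inj_on \<phi> \<bbbD>" and \<psi>: "\<psi> holomorphic_on \<bbbD>" "\<psi> ` \<bbbD> \<subseteq> \<phi> ` \<bbbD>"
    and eq: "\<psi> 0 = \<phi> 0" "deriv \<psi> 0 = deriv \<phi> 0" and z: "z \<in> \<bbbD>"
  shows "\<psi> z = \<phi> z"
proof -
  obtain g where g: "g holomorphic_on \<phi> ` \<bbbD>" "\<And>z. z \<in> \<bbbD> \<Longrightarrow> deriv \<phi> z * deriv g (\<phi> z) = 1"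
      "\<And>z. z \<in> \<bbbD> \<Longrightarrow> g (\<phi> z) = z"
    using holomorphic_has_inverse[OF \<phi>(1) open_ball \<phi>(2)] by blast
  define k where "k = g \<circ> \<psi>"
  have k_hol: "k holomorphic_on \<bbbD>"
    unfolding k_def by (rule holomorphic_on_compose_gen[OF \<psi>(1) g(1) \<psi>(2)])
  have k0: "k 0 = 0" using g(3)[of 0] eq by (simp add: k_def)
  have \<phi>k: "k w \<in> \<bbbD> \<and> \<phi> (k w) = \<psi> w" if "w \<in> \<bbbD>" for w
    using \<psi>(2) g(3) that unfolding k_def by fastforce
  have "open (\<phi> ` \<bbbD>)"
    using open_mapping_thm3[OF \<phi>(1) open_ball \<phi>(2)] .
  then have "(g has_field_derivative deriv g (\<phi> 0)) (at (\<phi> 0))"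
    by (intro holomorphic_derivI[OF g(1)]) auto
  then have "(k has_field_derivative deriv g (\<phi> 0) * deriv \<psi> 0) (at 0)"
    unfolding k_def o_def by (intro DERIV_chain2 holomorphic_derivI[OF \<psi>(1)]) (auto simp: eq)
  then have "deriv k 0 = 1"
    using DERIV_imp_deriv g(2)[of 0] eq(2) by (simp add: mult.commute) 
  then obtain \<alpha> where \<alpha>: "\<And>w. cmod w < 1 \<Longrightarrow> k w = \<alpha> * w"
    using Schwarz_Lemma(3)[OF k_hol k0, of 0] \<phi>k by auto
  have "(k has_field_derivative \<alpha>) (at 0)"
    by (rule has_field_derivative_transform_within_open[of "\<lambda>w. \<alpha> * w" _ _ \<bbbD>])
      (use \<alpha> in \<open>auto intro!: derivative_eq_intros\<close>)
  then have "\<alpha> = 1" using \<open>deriv k 0 = 1\<close> DERIV_imp_deriv by metis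
  then show ?thesis using \<alpha> \<phi>k[OF z] z by simp
qed

lemma ma_minda_taylor_coeff_Reals:
  assumes "ma_minda \<phi>"
  shows "taylor_coeff \<phi> n \<in> \<real>"
proof -
  have \<phi>: "\<phi> holomorphic_on \<bbbD>" "inj_on \<phi> \<bbbD>" "\<phi> 0 = 1" "deriv \<phi> 0 \<in> \<real>" "cnj ` (\<phi> ` \<bbbD>) = \<phi> ` \<bbbD>"
    using assms by (auto simp: ma_minda_def)
  have cnj_ball: "cnj ` \<bbbD> = \<bbbD>"
    by (auto simp: image_cnj_conv_vimage_cnj)
  define \<psi> where "\<psi> = cnj \<circ> \<phi> \<circ> cnj"
  have "(\<psi> has_field_derivative cnj (deriv \<phi> 0)) (at 0)"
    unfolding \<psi>_def using holomorphic_derivI[OF \<phi>(1) open_ball, of 0]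
    by (intro has_field_derivative_cnj_cnj) simp
  then have d: "deriv \<psi> 0 = deriv \<phi> 0"
    using \<phi>(4) by (simp add: DERIV_imp_deriv Reals_cnj_iff)
  have eq: "\<psi> z = \<phi> z" if "z \<in> \<bbbD>" for z
  proof (rule univalent_unique[OF \<phi>(1,2) _ _ _ d that])
    show "\<psi> holomorphic_on \<bbbD>"
      unfolding \<psi>_def using \<phi>(1) cnj_ball by (intro holomorphic_on_compose_cnj_cnj) auto
    show "\<psi> ` \<bbbD> \<subseteq> \<phi> ` \<bbbD>"
      unfolding \<psi>_def image_comp[symmetric] cnj_ball \<phi>(5) ..
    show "\<psi> 0 = \<phi> 0" by (simp add: \<psi>_def \<phi>(3))
  qed
  \<comment> \<open>Conjugating the series of \<open>\<phi>\<close> at \<open>cnj z\<close> expands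
    \<open>\<psi> z\<close>, which equals \<open>\<phi> z\<close>; uniqueness of coefficients then
    gives the claim.\<close>
  have "(\<lambda>n. cnj (taylor_coeff \<phi> n) * z ^ n) sums \<phi> z" if z: "z \<in> \<bbbD>" for z
  proof -
    have "(\<lambda>n. taylor_coeff \<phi> n * cnj z ^ n) sums \<phi> (cnj z)"
      using z by (intro taylor_coeff_sums \<phi>) simp
    then show ?thesis
      using eq[OF z] by (subst (asm) sums_cnj[symmetric]) (simp add: \<psi>_def)
  qed
  then have "taylor_coeff \<phi> n = cnj (taylor_coeff \<phi> n)"
    by (rule taylor_coeff_eqI)
  then show ?thesis by (simp add: Reals_cnj_iff)
qed

section \<open>Passing between \<open>f\<close>, its logarithm and the starlike quotient\<close>

lemma DERIV_times_exp:
  assumes L: "L holomorphic_on \<bbbD>" and f: "\<And>z. z \<in> \<bbbD> \<Longrightarrow> f z = z * exp (L z)" and z: "z \<in> \<bbbD>"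
  shows "(f has_field_derivative exp (L z) * (1 + z * deriv L z)) (at z)"
proof (rule has_field_derivative_transform_within_open[of "\<lambda>z. z * exp (L z)" _ _ \<bbbD>])
  show "((\<lambda>z. z * exp (L z)) has_field_derivative exp (L z) * (1 + z * deriv L z)) (at z)"
    using DERIV_mult[OF DERIV_ident DERIV_chain2[OF DERIV_exp holomorphic_derivI[OF L open_ball z]]]
    by (simp add: algebra_simps)
qed (use f z in auto)

text \<open>Away from 0 the exponential and the factor \<open>z\<close> cancel; at 0 the prescribed
  value 1 agrees with the right-hand side.\<close>

lemma starlike_quotient_times_exp:
  assumes "L holomorphic_on \<bbbD>" and "\<And>z. z \<in> \<bbbD> \<Longrightarrow> f z = z * exp (L z)" and "z \<in> \<bbbD>"
  shows "starlike_quotient f z = 1 + z * deriv L z"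
  using DERIV_imp_deriv[OF DERIV_times_exp[OF assms]] assms(2)[OF assms(3)]
  by (simp add: starlike_quotient_def)

text \<open>The quotient \<open>h z = f z / z\<close> has no zeros: off 0 by injectivity of
  \<open>f\<close>, at 0 because \<open>h 0 = deriv f 0 = 1\<close>. So it has a logarithm
  \<open>g\<close> on the disc, and \<open>exp (g 0) = 1\<close> permits subtracting
  \<open>g 0\<close>.\<close>

lemma class_S_log:
  assumes "f \<in> class_S"
  obtains L where "L holomorphic_on \<bbbD>" "L 0 = 0" "\<And>z. z \<in> \<bbbD> \<Longrightarrow> f z = z * exp (L z)"
proof -
  have f: "f holomorphic_on \<bbbD>" "inj_on f \<bbbD>" "f 0 = 0" "deriv f 0 = 1"
    using assms by (auto simp: class_S_def)
  obtain h where h: "h holomorphic_on \<bbbD>" "\<And>z. cmod z < 1 \<Longrightarrow> f z = z * h z" "h 0 = 1"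
    using Schwarz3[OF f(1,3)] f(4) by metis
  have "h z \<noteq> 0" if "z \<in> \<bbbD>" for z
  proof
    assume "h z = 0"
    then have "f z = f 0" using h(2) that f(3) by simp
    then have "z = 0" using f(2) that by (auto dest: inj_onD)
    then show False using \<open>h z = 0\<close> h(3) by simp
  qed
  then obtain g where g: "g holomorphic_on \<bbbD>" "\<And>z. z \<in> \<bbbD> \<Longrightarrow> h z = exp (g z)"
    using contractible_imp_holomorphic_log[OF h(1) convex_imp_contractible[OF convex_ball]] by metis
  show thesis
  proof
    show "(\<lambda>z. g z - g 0) holomorphic_on \<bbbD>"
      using g(1) by (intro holomorphic_intros)
    show "f z = z * exp (g z - g 0)" if "z \<in> \<bbbD>" for z
      using g(2)[of 0] g(2)[OF that] h(2,3) that by (simp add: exp_diff)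
  qed simp
qed

lemma log_coeff_1_2:
  assumes \<phi>: "\<phi> holomorphic_on \<bbbD>" and \<omega>: "schwarz_function \<omega>" and f: "f \<in> class_S"
    and eq: "\<forall>z\<in>\<bbbD>. starlike_quotient f z = \<phi> (\<omega> z)"
  shows "log_coeff f 1 = taylor_coeff \<phi> 1 * taylor_coeff \<omega> 1 / 2"
    and "log_coeff f 2 =
      (taylor_coeff \<phi> 1 * taylor_coeff \<omega> 2 + taylor_coeff \<phi> 2 * (taylor_coeff \<omega> 1)\<^sup>2) / 4"
proof -
  obtain L where L: "L holomorphic_on \<bbbD>" "L 0 = 0" "\<And>z. z \<in> \<bbbD> \<Longrightarrow> f z = z * exp (L z)"
    using class_S_log[OF f] by metis
  have lc: "log_coeff f n = taylor_coeff L n / 2" for n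
    by (rule log_coeff_eq[OF L(1,2)]) (simp add: L(3))
  have "\<forall>z\<in>\<bbbD>. 1 + z * deriv L z = \<phi> (\<omega> z)"
    using starlike_quotient_times_exp[OF L(1,3)] eq by simp
  note * = taylor_coeff_1_2_of_log_derivative[OF L(1) \<omega> \<phi> this]
  show "log_coeff f 1 = taylor_coeff \<phi> 1 * taylor_coeff \<omega> 1 / 2"
    unfolding lc *(1) by (rule refl)
  show "log_coeff f 2 =
      (taylor_coeff \<phi> 1 * taylor_coeff \<omega> 2 + taylor_coeff \<phi> 2 * (taylor_coeff \<omega> 1)\<^sup>2) / 4"
    unfolding lc *(2)[symmetric] by simp
qed

text \<open>Solves \<open>z * deriv L z = \<phi> (\<omega> z) - 1\<close>: the right-hand side
  vanishes at 0, so it can be divided by \<open>z\<close> and the quotient \<open>q\<close>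
  integrated over the disc.\<close>

lemma class_S_star_exists:
  assumes \<phi>: "\<phi> holomorphic_on \<bbbD>" "\<phi> 0 = 1" "\<And>z. z \<in> \<bbbD> \<Longrightarrow> Re (\<phi> z) > 0"
    and \<omega>: "schwarz_function \<omega>"
  obtains f where "f \<in> class_S_star \<phi>" "\<forall>z\<in>\<bbbD>. starlike_quotient f z = \<phi> (\<omega> z)"
proof -
  have \<omega>': "\<omega> holomorphic_on \<bbbD>" "\<omega> ` \<bbbD> \<subseteq> \<bbbD>" "\<omega> 0 = 0"
    using \<omega> by (auto simp: schwarz_function_def)
  have "(\<lambda>z. \<phi> (\<omega> z) - 1) holomorphic_on \<bbbD>"
    using holomorphic_on_compose_gen[OF \<omega>'(1) \<phi>(1) \<omega>'(2)]
    by (intro holomorphic_intros) (simp add: o_def)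
  then obtain q where q: "q holomorphic_on \<bbbD>" "\<And>z. cmod z < 1 \<Longrightarrow> \<phi> (\<omega> z) - 1 = z * q z"
    using Schwarz3[of "\<lambda>z. \<phi> (\<omega> z) - 1" 1] \<omega>'(3) \<phi>(2) by auto
  obtain M where M: "\<And>z. z \<in> \<bbbD> \<Longrightarrow> (M has_field_derivative q z) (at z within \<bbbD>)"
    using holomorphic_convex_primitive'[OF convex_ball open_ball q(1)] by metis
  define L where "L = (\<lambda>z. M z - M 0)"
  have L': "(L has_field_derivative q z) (at z)" if "z \<in> \<bbbD>" for z
    using DERIV_diff[OF M[OF that] DERIV_const[of "M 0"]] that
    by (simp add: L_def at_within_open[OF _ open_ball])
  have L: "L holomorphic_on \<bbbD>"
    unfolding holomorphic_on_open[OF open_ball] using L' by blast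
  have zL': "1 + z * deriv L z = \<phi> (\<omega> z)" if "z \<in> \<bbbD>" for z
    using DERIV_imp_deriv[OF L'[OF that]] q(2)[of z] that by (simp add: algebra_simps)
  define f where "f = (\<lambda>z. z * exp (L z))"
  have quot: "starlike_quotient f z = \<phi> (\<omega> z)" if "z \<in> \<bbbD>" for z
    using starlike_quotient_times_exp[OF L _ that, of f] zL'[OF that] by (simp add: f_def)
  have "inj_on f \<bbbD>"
    unfolding f_def by (rule inj_on_times_exp[OF L]) (use zL' \<phi>(3) \<omega>'(2) in \<open>auto simp: image_subset_iff\<close>)
  moreover have "f holomorphic_on \<bbbD>"
    unfolding f_def by (intro holomorphic_intros L)
  moreover have "deriv f 0 = 1"
    using DERIV_imp_deriv[OF DERIV_times_exp[OF L, of f 0]] by (simp add: f_def L_def)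
  ultimately have "f \<in> class_S"
    by (simp add: class_S_def f_def)
  then have "f \<in> class_S_star \<phi>"
    using \<omega> quot by (auto simp: class_S_star_def subordinate_def)
  then show thesis using that quot by blast
qed

section \<open>The sharp estimate\<close>

theorem theorem2p1:
  fixes \<phi> :: "complex \<Rightarrow> complex" and B :: "nat \<Rightarrow> real"
  assumes "ma_minda \<phi>"
    and "\<And>n. B n = Re (taylor_coeff \<phi> n)"
  shows "(\<forall>n. taylor_coeff \<phi> n = complex_of_real (B n)) \<and> B 1 > 0 \<and>
    (\<bar>B 2\<bar> \<ge> B 1 \<longrightarrow>
      (\<forall>f\<in>class_S_star \<phi>.
         cmod ((log_coeff f 1)\<^sup>2 - (log_coeff f 2)\<^sup>2) \<le> (B 1)\<^sup>2 / 4 + (B 2)\<^sup>2 / 16) \<and>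
      (\<exists>f\<in>class_S_star \<phi>.
         cmod ((log_coeff f 1)\<^sup>2 - (log_coeff f 2)\<^sup>2) = (B 1)\<^sup>2 / 4 + (B 2)\<^sup>2 / 16))"
proof (intro conjI impI ballI allI)
  have \<phi>: "\<phi> holomorphic_on \<bbbD>" "\<phi> 0 = 1" "\<And>z. z \<in> \<bbbD> \<Longrightarrow> Re (\<phi> z) > 0"
    using assms(1) by (auto simp: ma_minda_def)
  show B: "taylor_coeff \<phi> n = complex_of_real (B n)" for n
    using ma_minda_taylor_coeff_Reals[OF assms(1)] assms(2) by (simp add: of_real_Re)
  show B1: "B 1 > 0"
    using assms by (simp add: ma_minda_def taylor_coeff_def)
  assume le: "\<bar>B 2\<bar> \<ge> B 1"
  show "cmod ((log_coeff f 1)\<^sup>2 - (log_coeff f 2)\<^sup>2) \<le> (B 1)\<^sup>2 / 4 + (B 2)\<^sup>2 / 16"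
    if f: "f \<in> class_S_star \<phi>" for f
  proof -
    obtain \<omega> where \<omega>: "schwarz_function \<omega>" "\<forall>z\<in>\<bbbD>. starlike_quotient f z = \<phi> (\<omega> z)"
      and fS: "f \<in> class_S"
      using f by (auto simp: class_S_star_def subordinate_def)
    define c where "c = taylor_coeff \<omega>"
    note lc = log_coeff_1_2[OF \<phi>(1) \<omega>(1) fS \<omega>(2), folded c_def, unfolded B]
    have c: "cmod (c 2) \<le> 1 - (cmod (c 1))\<^sup>2"
      unfolding c_def by (rule schwarz_function_taylor_coeff_2_le[OF \<omega>(1)])
    then have c1: "(cmod (c 1))\<^sup>2 \<le> 1" using norm_ge_zero[of "c 2"] by linarith
    have norm1: "cmod (log_coeff f 1) = B 1 * cmod (c 1) / 2"
      using B1 unfolding lc(1) by (simp add: norm_mult norm_divide)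
    have 1: "(cmod (log_coeff f 1))\<^sup>2 \<le> (B 1)\<^sup>2 / 4"
      unfolding norm1 using mult_left_mono[OF c1, of "(B 1)\<^sup>2 / 4"]
      by (simp add: power_mult_distrib power_divide)
    have "cmod (of_real (B 1) * c 2 + of_real (B 2) * (c 1)\<^sup>2) \<le>
        B 1 * cmod (c 2) + \<bar>B 2\<bar> * (cmod (c 1))\<^sup>2"
      using B1 by (intro norm_triangle_le) (simp add: norm_mult norm_power)
    \<comment> \<open>Both terms now carry the factor \<open>\<bar>B 2\<bar>\<close>, and their
      weights add up to 1.\<close>
    also have "\<dots> \<le> \<bar>B 2\<bar> * (1 - (cmod (c 1))\<^sup>2) + \<bar>B 2\<bar> * (cmod (c 1))\<^sup>2"
      using B1 le c by (intro add_right_mono mult_mono) auto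
    finally have "cmod (log_coeff f 2) \<le> \<bar>B 2\<bar> / 4"
      unfolding lc(2) by (simp add: norm_divide algebra_simps)
    then have 2: "(cmod (log_coeff f 2))\<^sup>2 \<le> (B 2)\<^sup>2 / 16"
      using power_mono[of "cmod (log_coeff f 2)" "\<bar>B 2\<bar> / 4" 2] by (simp add: power_divide)
    show ?thesis
      using norm_triangle_ineq4[of "(log_coeff f 1)\<^sup>2" "(log_coeff f 2)\<^sup>2"] 1 2
      by (simp add: norm_power)
  qed
  show "\<exists>f\<in>class_S_star \<phi>.
      cmod ((log_coeff f 1)\<^sup>2 - (log_coeff f 2)\<^sup>2) = (B 1)\<^sup>2 / 4 + (B 2)\<^sup>2 / 16"
  proof -
    \<comment> \<open>This choice gives \<open>log_coeff f 1 = \<i> * B 1 / 2\<close> and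
      \<open>log_coeff f 2 = - B 2 / 4\<close>, so the two terms of the difference are nonpositive
      reals and their moduli add.\<close>
    define \<omega> :: "complex \<Rightarrow> complex" where "\<omega> = (\<lambda>z. \<i> * z)"
    have \<omega>: "schwarz_function \<omega>"
      by (auto simp: schwarz_function_def \<omega>_def norm_mult intro!: holomorphic_intros)
    have c: "taylor_coeff \<omega> 1 = \<i>" "taylor_coeff \<omega> 2 = 0"
      using taylor_coeff_Suc_times_ident[of "\<lambda>_. \<i>" \<omega> 0] taylor_coeff_Suc_times_ident[of "\<lambda>_. \<i>" \<omega> 1]
      by (simp_all add: \<omega>_def taylor_coeff_def numeral_2_eq_2)
    obtain f where f: "f \<in> class_S_star \<phi>" "\<forall>z\<in>\<bbbD>. starlike_quotient f z = \<phi> (\<omega> z)"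
      using class_S_star_exists[OF \<phi> \<omega>] by metis
    have "f \<in> class_S" using f(1) by (simp add: class_S_star_def)
    note lc = log_coeff_1_2[OF \<phi>(1) \<omega> this f(2), unfolded B c]
    have "(log_coeff f 1)\<^sup>2 - (log_coeff f 2)\<^sup>2 = - of_real ((B 1)\<^sup>2 / 4 + (B 2)\<^sup>2 / 16)"
      unfolding lc by (simp add: power_mult_distrib power_divide)
    then have "cmod ((log_coeff f 1)\<^sup>2 - (log_coeff f 2)\<^sup>2) = (B 1)\<^sup>2 / 4 + (B 2)\<^sup>2 / 16"
      by (simp only: norm_minus_cancel norm_of_real) simp
    then show ?thesis using f(1) by blast
  qed
qed

end
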